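(* Let $p$ be a prime. With pointwise addition and multiplication, $\mathcal{K}_{p,1}$ and $\mathcal{K}_{p,2}$ are commutative rings, and their unit groups are $\mathcal{K}^*_{p,1}=\{f\in\mathcal{K}_{p,1}:f(0)\in\mathbb{Z}_p^*\}$ and $\mathcal{K}^*_{p,2}=\{f\in\mathcal{K}_{p,2}:f(0)\in\mathbb{Z}_p^*\}$, respectively.
   Context: $\mathcal{K}_{p,1}$ is the set of $f:\mathbb{Z}_p\to\mathbb{Z}_p$ such that for all $s\ne t$ in $\mathbb{Z}_p$ and all $n\ge0$: $s\equiv t\pmod{p^n}$ implies $f(s)\equiv f(t)\pmod{p^{n+1}}$. $\mathcal{K}_{p,2}$ is the set of $f:\mathbb{Z}_p\to\mathbb{Z}_p$ with $\Delta^n f(s)\equiv0\pmod{p^n\mathbb{Z}_p}$ for all $s\in\mathbb{Z}_p$, $n\ge0$, where $\Delta^n f(s)=\sum_{\nu=0}^n\binom{n}{\nu}(-1)^{n-\nu}f(s+\nu)$.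
   Formalization: K_{p,2} is taken to consist of continuous functions only; without continuity the unit claim fails: the indicator function of the integers in Z_p has Δ^n f = 0 for n ≥ 1 and f(0) = 1 but vanishes at 1/(1+p), so it is not a unit. *)

theory Defs
  imports "HOL-Computational_Algebra.Primes" "HOL-Algebra.Ideal"
begin

text \<open>
  The ring of p-adic integers as the inverse limit of the rings of integers modulo p^n:
  the entry \<open>x n\<close> is the representative in \<open>{0..<p^n}\<close> of the residue of \<open>x\<close> modulo \<open>p^n\<close>.
\<close>

definition Zp :: "nat \<Rightarrow> (nat \<Rightarrow> int) ring" where
  "Zp p = \<lparr>
     carrier = {x. \<forall>n. x n \<in> {0..<int p ^ n} \<and> x (Suc n) mod int p ^ n = x n},
     mult = (\<lambda>x y n. (x n * y n) mod int p ^ n),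
     one = (\<lambda>n. 1 mod int p ^ n),
     zero = (\<lambda>n. 0),
     add = (\<lambda>x y n. (x n + y n) mod int p ^ n)\<rparr>"

definition Zp_of_nat :: "nat \<Rightarrow> nat \<Rightarrow> nat \<Rightarrow> int" where
  "Zp_of_nat p k = [k] \<cdot>\<^bsub>Zp p\<^esub> \<one>\<^bsub>Zp p\<^esub>"

definition Zp_cong :: "nat \<Rightarrow> nat \<Rightarrow> (nat \<Rightarrow> int) \<Rightarrow> (nat \<Rightarrow> int) \<Rightarrow> bool" where
  "Zp_cong p n x y \<longleftrightarrow> x \<ominus>\<^bsub>Zp p\<^esub> y \<in> PIdl\<^bsub>Zp p\<^esub> (Zp_of_nat p (p ^ n))"

definition Zp_diff ::
  "nat \<Rightarrow> nat \<Rightarrow> ((nat \<Rightarrow> int) \<Rightarrow> (nat \<Rightarrow> int)) \<Rightarrow> (nat \<Rightarrow> int) \<Rightarrow> (nat \<Rightarrow> int)" where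
  "Zp_diff p n f s =
     (\<Oplus>\<^bsub>Zp p\<^esub>\<nu>\<in>{0..n}. [(int (n choose \<nu>) * (-1) ^ (n - \<nu>))] \<cdot>\<^bsub>Zp p\<^esub> f (s \<oplus>\<^bsub>Zp p\<^esub> Zp_of_nat p \<nu>))"

text \<open>Continuity for the p-adic topology, whose basic neighbourhoods of \<open>s\<close> are the cosets \<open>s + p^m Z_p\<close>.\<close>

definition Zp_continuous :: "nat \<Rightarrow> ((nat \<Rightarrow> int) \<Rightarrow> (nat \<Rightarrow> int)) \<Rightarrow> bool" where
  "Zp_continuous p f \<longleftrightarrow>
     (\<forall>s\<in>carrier (Zp p). \<forall>n. \<exists>m. \<forall>t\<in>carrier (Zp p). Zp_cong p m s t \<longrightarrow> Zp_cong p n (f s) (f t))"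

text \<open>Functions on the carrier are represented extensionally (\<open>undefined\<close> off the carrier), so that
  equality in a function ring is equality of functions from \<open>Z_p\<close> to \<open>Z_p\<close>.\<close>

definition Kummer1 :: "nat \<Rightarrow> ((nat \<Rightarrow> int) \<Rightarrow> (nat \<Rightarrow> int)) set" where
  "Kummer1 p = {f \<in> carrier (Zp p) \<rightarrow>\<^sub>E carrier (Zp p).
     \<forall>s\<in>carrier (Zp p). \<forall>t\<in>carrier (Zp p). s \<noteq> t \<longrightarrow>
       (\<forall>n. Zp_cong p n s t \<longrightarrow> Zp_cong p (Suc n) (f s) (f t))}"

text \<open>
  Members of the second space are required to be continuous. The difference condition by itself
  only relates values along cosets of the integers: the indicator function of the (rational)
  integers in \<open>Z_p\<close> has \<open>\<Delta>\<^sup>n f = 0\<close> for all \<open>n \<ge> 1\<close> and value 1 at 0, but it vanishes somewhere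
  and hence is not invertible. Members of the first space are automatically continuous.
\<close>

definition Kummer2 :: "nat \<Rightarrow> ((nat \<Rightarrow> int) \<Rightarrow> (nat \<Rightarrow> int)) set" where
  "Kummer2 p = {f \<in> carrier (Zp p) \<rightarrow>\<^sub>E carrier (Zp p).
     Zp_continuous p f \<and>
     (\<forall>s\<in>carrier (Zp p). \<forall>n. Zp_cong p n (Zp_diff p n f s) \<zero>\<^bsub>Zp p\<^esub>)}"

definition pointwise_ring ::
  "nat \<Rightarrow> ((nat \<Rightarrow> int) \<Rightarrow> (nat \<Rightarrow> int)) set \<Rightarrow> ((nat \<Rightarrow> int) \<Rightarrow> (nat \<Rightarrow> int)) ring" where
  "pointwise_ring p K = \<lparr>
     carrier = K,
     mult = (\<lambda>f g. \<lambda>s\<in>carrier (Zp p). f s \<otimes>\<^bsub>Zp p\<^esub> g s),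
     one = (\<lambda>s\<in>carrier (Zp p). \<one>\<^bsub>Zp p\<^esub>),
     zero = (\<lambda>s\<in>carrier (Zp p). \<zero>\<^bsub>Zp p\<^esub>),
     add = (\<lambda>f g. \<lambda>s\<in>carrier (Zp p). f s \<oplus>\<^bsub>Zp p\<^esub> g s)\<rparr>"

end

theory Submission
  imports Defs "HOL-Number_Theory.Cong"
begin

text \<open>
  Both unit groups come out of the same two observations: a member \<open>f\<close> of either space is constant
  modulo \<open>p\<close>, so that \<open>f(0)\<close> being a unit makes every value a unit, and the pointwise inverse lies in
  the space again. For the second space, constancy modulo \<open>p\<close> holds on the natural numbers because
  \<open>p\<close> divides \<open>\<Delta> f\<close>, and extends to \<open>Z_p\<close> by continuity and density. The difference conditions
  at \<open>s\<close> are divisibility statements about the integer sequences \<open>\<nu> \<mapsto> f(s + \<nu>) mod p^N\<close>; they pass to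
  products by the Leibniz rule \<open>\<Delta>(a b) = E a \<cdot> \<Delta> b + \<Delta> a \<cdot> b\<close>, where \<open>E\<close> is the shift.
\<close>

section \<open>Divisibility of iterated forward differences of integer sequences\<close>

definition fdiff :: "(nat \<Rightarrow> int) \<Rightarrow> nat \<Rightarrow> int" where
  "fdiff a j = a (Suc j) - a j"

lemma fdiff_funpow_Suc: "(fdiff ^^ Suc k) a j = (fdiff ^^ k) a (Suc j) - (fdiff ^^ k) a j"
  by (simp add: fdiff_def)

lemma fdiff_funpow_shift: "(fdiff ^^ k) (\<lambda>j. a (j + i)) j = (fdiff ^^ k) a (j + i)"
  by (induction k arbitrary: j) (simp_all add: fdiff_def)

lemma fdiff_funpow_add:
  "(fdiff ^^ k) (\<lambda>j. a j + b j) j = (fdiff ^^ k) a j + (fdiff ^^ k) b j"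
  by (induction k arbitrary: j) (simp_all add: fdiff_def)

lemma fdiff_funpow_uminus: "(fdiff ^^ k) (\<lambda>j. - a j) j = - (fdiff ^^ k) a j"
  by (induction k arbitrary: j) (simp_all add: fdiff_def)

text \<open>Iterated differences are integer combinations of entries and so respect congruences;
  this permits passing between levels and between representatives of a residue.\<close>

lemma fdiff_funpow_cong_mod:
  assumes "\<And>j. [a j = b j] (mod m)"
  shows "[(fdiff ^^ k) a j = (fdiff ^^ k) b j] (mod m)"
proof (induction k arbitrary: j)
  case 0
  show ?case using assms by simp
next
  case (Suc k)
  show ?case unfolding fdiff_funpow_Suc using Suc by (intro cong_diff)
qed

text \<open>Pascal's rule. It connects the binomial sum in \<open>Zp_diff\<close> with an iterate,
  which suits induction on the order.\<close>

lemma fdiff_funpow_eq_sum: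
  "(fdiff ^^ n) a j = (\<Sum>\<nu>\<in>{0..n}. int (n choose \<nu>) * (-1) ^ (n - \<nu>) * a (j + \<nu>))"
proof (induction n arbitrary: j)
  case 0
  show ?case by simp
next
  case (Suc n)
  let ?c = "\<lambda>n \<nu>. int (n choose \<nu>) * (-1) ^ (n - \<nu>)"
  have "(\<Sum>\<nu>\<in>{0..Suc n}. ?c (Suc n) \<nu> * a (j + \<nu>))
      = ?c (Suc n) 0 * a j + (\<Sum>\<nu>\<in>{0..n}. ?c (Suc n) (Suc \<nu>) * a (j + Suc \<nu>))"
    by (simp only: sum.atLeast0_atMost_Suc_shift o_def add_0_right)
  also have "(\<Sum>\<nu>\<in>{0..n}. ?c (Suc n) (Suc \<nu>) * a (j + Suc \<nu>))
      = (\<Sum>\<nu>\<in>{0..n}. ?c n \<nu> * a (Suc j + \<nu>))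
        + (\<Sum>\<nu>\<in>{0..n}. int (n choose Suc \<nu>) * (-1) ^ (n - \<nu>) * a (j + Suc \<nu>))"
    by (simp add: sum.distrib algebra_simps)
  \<comment> \<open>The term \<open>\<nu> = n\<close> vanishes because
    \<open>n choose Suc n = 0\<close>; in the others, lowering the exponent of \<open>-1\<close> by
    one produces the minus sign.\<close>
  also have "(\<Sum>\<nu>\<in>{0..n}. int (n choose Suc \<nu>) * (-1) ^ (n - \<nu>) * a (j + Suc \<nu>))
      = (\<Sum>\<nu>\<in>{0..<n}. - (?c n (Suc \<nu>) * a (j + Suc \<nu>)))"
    unfolding atLeast0AtMost lessThan_Suc_atMost[symmetric] sum.lessThan_Suc atLeast0LessThan
    by (auto intro!: sum.cong simp: Suc_diff_Suc[symmetric])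
  also have "?c (Suc n) 0 * a j
        + ((\<Sum>\<nu>\<in>{0..n}. ?c n \<nu> * a (Suc j + \<nu>)) + (\<Sum>\<nu>\<in>{0..<n}. - (?c n (Suc \<nu>) * a (j + Suc \<nu>))))
      = (\<Sum>\<nu>\<in>{0..n}. ?c n \<nu> * a (Suc j + \<nu>)) - (\<Sum>\<nu>\<in>{0..n}. ?c n \<nu> * a (j + \<nu>))"
    by (simp add: sum_negf atLeast0AtMost atLeast0LessThan sum.atMost_shift)
  finally show ?case by (simp only: fdiff_funpow_Suc Suc.IH)
qed

text \<open>The offsets \<open>u\<close> and \<open>v\<close> make the induction close: in each
  Leibniz summand one factor is differenced, which lowers the order by one and raises the offset of
  that factor by one, so the total exponent is unchanged.\<close>

lemma dvd_fdiff_funpow_mult: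
  fixes q :: int
  assumes "\<And>i j. i \<le> k \<Longrightarrow> q ^ (i + u) dvd (fdiff ^^ i) a j"
    and "\<And>i j. i \<le> k \<Longrightarrow> q ^ (i + v) dvd (fdiff ^^ i) b j"
  shows "q ^ (k + u + v) dvd (fdiff ^^ k) (\<lambda>j. a j * b j) j"
  using assms
proof (induction k arbitrary: a b u v j)
  case 0
  show ?case using mult_dvd_mono[OF "0.prems"(1)[of 0] "0.prems"(2)[of 0]] by (simp add: power_add)
next
  case (Suc k)
  have "fdiff (\<lambda>j. a j * b j) = (\<lambda>j. a (j + 1) * fdiff b j + fdiff a j * b j)"
    by (simp add: fun_eq_iff fdiff_def algebra_simps)
  then have eq: "(fdiff ^^ Suc k) (\<lambda>j. a j * b j) j
      = (fdiff ^^ k) (\<lambda>j. a (j + 1) * fdiff b j) j + (fdiff ^^ k) (\<lambda>j. fdiff a j * b j) j"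
    by (simp only: funpow_Suc_right o_def fdiff_funpow_add)
  have a: "q ^ (i + u) dvd (fdiff ^^ i) (\<lambda>j. a (j + 1)) j" if "i \<le> k" for i j
    using Suc.prems(1)[of i "j + 1"] that by (simp only: fdiff_funpow_shift)
  have da: "q ^ (i + Suc u) dvd (fdiff ^^ i) (fdiff a) j" if "i \<le> k" for i j
    using Suc.prems(1)[of "Suc i" j] that by (simp add: funpow_swap1)
  have db: "q ^ (i + Suc v) dvd (fdiff ^^ i) (fdiff b) j" if "i \<le> k" for i j
    using Suc.prems(2)[of "Suc i" j] that by (simp add: funpow_swap1)
  have b: "q ^ (i + v) dvd (fdiff ^^ i) b j" if "i \<le> k" for i j
    using Suc.prems(2)[of i j] that by simp
  have "q ^ (k + u + Suc v) dvd (fdiff ^^ k) (\<lambda>j. a (j + 1) * fdiff b j) j"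
    by (rule Suc.IH[OF a db])
  moreover have "q ^ (k + Suc u + v) dvd (fdiff ^^ k) (\<lambda>j. fdiff a j * b j) j"
    by (rule Suc.IH[OF da b])
  ultimately show ?case unfolding eq by (intro dvd_add) simp_all
qed

text \<open>Since \<open>\<Delta> b = - \<Delta> a \<cdot> b \<cdot> E b\<close> for \<open>b = 1 / a\<close>, the divisibility of
  \<open>\<Delta>\<^sup>k b\<close> lifts one order at a time.\<close>

lemma dvd_fdiff_funpow_inverse:
  fixes q :: int
  assumes a: "\<And>i j. i \<le> N \<Longrightarrow> q ^ i dvd (fdiff ^^ i) a j"
    and ab: "\<And>j. [a j * b j = 1] (mod q ^ N)"
    and "k \<le> N"
  shows "q ^ k dvd (fdiff ^^ k) b j"
  using \<open>k \<le> N\<close>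
\<comment> \<open>Strong induction, since the product \<open>b j * b (j + 1)\<close> involves all
  orders of \<open>b\<close> below \<open>k\<close>.\<close>
proof (induction k arbitrary: j rule: less_induct)
  case (less k)
  show ?case
  proof (cases k)
    case 0
    then show ?thesis by simp
  next
    case (Suc k')
    have b: "q ^ (i + 0) dvd (fdiff ^^ i) b j" if "i \<le> k'" for i j
      using less that Suc by simp
    have b1: "q ^ (i + 0) dvd (fdiff ^^ i) (\<lambda>j. b (j + 1)) j" if "i \<le> k'" for i j
      using b[of i "j + 1"] that by (simp only: fdiff_funpow_shift)
    have "q ^ (i + 1) dvd (fdiff ^^ i) (fdiff a) j" if "i \<le> k'" for i j
      using a[of "Suc i" j] that less.prems Suc by (simp add: funpow_swap1)
    moreover have "q ^ (i + 0) dvd (fdiff ^^ i) (\<lambda>j. b j * b (j + 1)) j" if "i \<le> k'" for i j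
      using dvd_fdiff_funpow_mult[of i q 0 b 0 "\<lambda>j. b (j + 1)" j] b b1 that by simp
    \<comment> \<open>The factor \<open>fdiff a\<close> has offset 1, being already differenced
      once; this supplies the missing power, as \<open>k' + 1 = k\<close>.\<close>
    ultimately have "q ^ (k' + 1 + 0) dvd (fdiff ^^ k') (\<lambda>j. fdiff a j * (b j * b (j + 1))) j"
      by (rule dvd_fdiff_funpow_mult)
    moreover have "[- fdiff b j = fdiff a j * (b j * b (j + 1))] (mod q ^ N)" for j
    proof -
      have "[b j - b (j + 1) = (a (j + 1) * b (j + 1)) * b j - (a j * b j) * b (j + 1)] (mod q ^ N)"
        using cong_diff[OF cong_scalar_right[OF ab[of "j + 1"], of "b j"]
            cong_scalar_right[OF ab[of j], of "b (j + 1)"]]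
        by (simp add: cong_sym)
      then show ?thesis by (simp add: fdiff_def algebra_simps)
    qed
    then have "[(fdiff ^^ k') (\<lambda>j. - fdiff b j) j = (fdiff ^^ k') (\<lambda>j. fdiff a j * (b j * b (j + 1))) j]
        (mod q ^ N)"
      by (rule fdiff_funpow_cong_mod)
    then have "[(fdiff ^^ k') (\<lambda>j. - fdiff b j) j = (fdiff ^^ k') (\<lambda>j. fdiff a j * (b j * b (j + 1))) j]
        (mod q ^ k)"
      using less.prems by (auto intro: cong_dvd_modulus le_imp_power_dvd)
    ultimately have "q ^ k dvd (fdiff ^^ k') (\<lambda>j. - fdiff b j) j"
      using Suc cong_dvd_iff by fastforce
    moreover have "(fdiff ^^ k') (\<lambda>j. - fdiff b j) j = - (fdiff ^^ k) b j"
      using Suc by (simp add: fdiff_funpow_uminus funpow_swap1)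
    ultimately show ?thesis by simp
  qed
qed

section \<open>The ring structure of Z_p, entry by entry\<close>

lemma carrier_Zp_iff:
  "x \<in> carrier (Zp p) \<longleftrightarrow> (\<forall>n. x n \<in> {0..<int p ^ n} \<and> x (Suc n) mod int p ^ n = x n)"
  by (simp add: Zp_def)

lemma Zp_add_nth: "(x \<oplus>\<^bsub>Zp p\<^esub> y) n = (x n + y n) mod int p ^ n"
  by (simp add: Zp_def)

lemma Zp_mult_nth: "(x \<otimes>\<^bsub>Zp p\<^esub> y) n = (x n * y n) mod int p ^ n"
  by (simp add: Zp_def)

lemma Zp_zero_nth: "\<zero>\<^bsub>Zp p\<^esub> n = 0"
  by (simp add: Zp_def)

lemma Zp_one_nth: "\<one>\<^bsub>Zp p\<^esub> n = 1 mod int p ^ n"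
  by (simp add: Zp_def)

lemmas Zp_nth = Zp_add_nth Zp_mult_nth Zp_zero_nth Zp_one_nth

lemma Zp_nth_mod:
  assumes "x \<in> carrier (Zp p)"
  shows "x n mod int p ^ n = x n"
  using assms by (simp add: carrier_Zp_iff)

lemma Zp_nth_mod_le:
  assumes "x \<in> carrier (Zp p)" "m \<le> n"
  shows "x n mod int p ^ m = x m"
  using \<open>m \<le> n\<close>
proof (induction n rule: dec_induct)
  case base
  show ?case using assms by (simp add: Zp_nth_mod)
next
  case (step n)
  have "x (Suc n) mod int p ^ m = x (Suc n) mod int p ^ n mod int p ^ m"
    using step.hyps by (simp add: mod_mod_cancel le_imp_power_dvd)
  also have "\<dots> = x m"
    using assms step.IH by (simp add: carrier_Zp_iff)
  finally show ?case .
qed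

context
  fixes p :: nat
  assumes prime_p: "prime p"
begin

lemma power_p_pos: "0 < int p ^ n"
  using prime_gt_0_nat[OF prime_p] by simp

text \<open>Constructor for elements of Z_p: the representatives may be arbitrary integers, since
  reducing them does not disturb the compatibility of neighbouring levels. Closure under the ring
  operations comes from here.\<close>

lemma mod_power_in_carrier_Zp:
  assumes "\<And>n. [z (Suc n) = z n] (mod int p ^ n)"
  shows "(\<lambda>n. z n mod int p ^ n) \<in> carrier (Zp p)"
  using assms power_p_pos unfolding carrier_Zp_iff cong_def
  by (simp add: mod_mod_cancel)

lemma cong_nth_Suc:
  assumes "x \<in> carrier (Zp p)"
  shows "[x (Suc n) = x n] (mod int p ^ n)"
  using assms by (simp add: carrier_Zp_iff cong_def)

lemma Zp_add_closed:
  "x \<in> carrier (Zp p) \<Longrightarrow> y \<in> carrier (Zp p) \<Longrightarrow> x \<oplus>\<^bsub>Zp p\<^esub> y \<in> carrier (Zp p)"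
  using mod_power_in_carrier_Zp[of "\<lambda>n. x n + y n"] cong_nth_Suc
  by (simp add: Zp_def cong_add)

lemma Zp_mult_closed:
  "x \<in> carrier (Zp p) \<Longrightarrow> y \<in> carrier (Zp p) \<Longrightarrow> x \<otimes>\<^bsub>Zp p\<^esub> y \<in> carrier (Zp p)"
  using mod_power_in_carrier_Zp[of "\<lambda>n. x n * y n"] cong_nth_Suc
  by (simp add: Zp_def cong_mult)

lemma Zp_uminus_closed:
  "x \<in> carrier (Zp p) \<Longrightarrow> (\<lambda>n. - x n mod int p ^ n) \<in> carrier (Zp p)"
  using mod_power_in_carrier_Zp[of "\<lambda>n. - x n"] cong_nth_Suc
  by (simp add: cong_minus_minus_iff)

lemma Zp_of_int_closed: "(\<lambda>n. k mod int p ^ n) \<in> carrier (Zp p)"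
  by (rule mod_power_in_carrier_Zp) simp

lemma cring_Zp: "cring (Zp p)"
proof (rule cringI)
  have zero: "\<zero>\<^bsub>Zp p\<^esub> \<in> carrier (Zp p)"
    using Zp_of_int_closed[of 0] by (simp add: Zp_def)
  show "abelian_group (Zp p)"
  proof (rule abelian_groupI)
    fix x assume x: "x \<in> carrier (Zp p)"
    then show "\<exists>y\<in>carrier (Zp p). y \<oplus>\<^bsub>Zp p\<^esub> x = \<zero>\<^bsub>Zp p\<^esub>"
      by (intro bexI[OF _ Zp_uminus_closed[OF x]]) (simp add: fun_eq_iff Zp_nth mod_simps)
  qed (auto simp: zero Zp_add_closed fun_eq_iff Zp_nth Zp_nth_mod mod_simps ac_simps)
  show "comm_monoid (Zp p)"
  proof (rule comm_monoidI)
    show "\<one>\<^bsub>Zp p\<^esub> \<in> carrier (Zp p)"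
      using Zp_of_int_closed[of 1] by (simp add: Zp_def)
  qed (auto simp: Zp_mult_closed fun_eq_iff Zp_nth Zp_nth_mod mod_simps ac_simps)
qed (simp add: fun_eq_iff Zp_nth mod_simps distrib_right)

interpretation Z: cring "Zp p"
  by (rule cring_Zp)

lemma Zp_uminus_nth:
  assumes "x \<in> carrier (Zp p)"
  shows "(\<ominus>\<^bsub>Zp p\<^esub> x) n = - x n mod int p ^ n"
proof -
  have "\<ominus>\<^bsub>Zp p\<^esub> x = (\<lambda>n. - x n mod int p ^ n)"
    using assms by (intro Z.minus_equality Zp_uminus_closed) (simp_all add: fun_eq_iff Zp_nth mod_simps)
  then show ?thesis by simp
qed

lemma Zp_nat_pow_nth:
  assumes "x \<in> carrier (Zp p)"
  shows "([(k::nat)] \<cdot>\<^bsub>Zp p\<^esub> x) n = int k * x n mod int p ^ n"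
  using assms by (induction k) (simp_all add: Zp_nth mod_simps distrib_right add.commute)

lemma Zp_int_pow_nth:
  assumes "x \<in> carrier (Zp p)"
  shows "([(k::int)] \<cdot>\<^bsub>Zp p\<^esub> x) n = k * x n mod int p ^ n"
proof (cases "k \<ge> 0")
  case True
  then show ?thesis using assms by (simp add: add_pow_int_ge Zp_nat_pow_nth)
next
  case False
  then have "[k] \<cdot>\<^bsub>Zp p\<^esub> x = \<ominus>\<^bsub>Zp p\<^esub> ([nat (- k)] \<cdot>\<^bsub>Zp p\<^esub> x)"
    by (intro add_pow_int_lt) simp
  then show ?thesis
    using assms False by (simp add: Zp_uminus_nth Zp_nat_pow_nth mod_simps)
qed

lemma Zp_finsum_nth:
  assumes "finite A" "g \<in> A \<rightarrow> carrier (Zp p)"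
  shows "(\<Oplus>\<^bsub>Zp p\<^esub>i\<in>A. g i) n = (\<Sum>i\<in>A. g i n) mod int p ^ n"
  using assms by (induction A rule: finite_induct) (simp_all add: Zp_nth mod_simps Pi_iff)

lemma Zp_of_nat_nth: "Zp_of_nat p k n = int k mod int p ^ n"
  unfolding Zp_of_nat_def by (simp add: Zp_nat_pow_nth Zp_nth mod_simps)

lemma Zp_of_nat_closed: "Zp_of_nat p k \<in> carrier (Zp p)"
  unfolding Zp_of_nat_def by simp

section \<open>Congruences, units and inverses read off from single residues\<close>

text \<open>A multiple of \<open>p ^ n\<close> has vanishing \<open>n\<close>-th entry by
  evaluation; conversely, such an element can be divided by \<open>p ^ n\<close> explicitly.
  Congruences thereby become equalities of single entries.\<close>

lemma Zp_cong_iff: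
  assumes x: "x \<in> carrier (Zp p)" and y: "y \<in> carrier (Zp p)"
  shows "Zp_cong p n x y \<longleftrightarrow> x n = y n"
proof -
  define z where "z = x \<ominus>\<^bsub>Zp p\<^esub> y"
  have z: "z \<in> carrier (Zp p)"
    using x y by (simp add: z_def)
  have "z n = (x n - y n) mod int p ^ n"
    using x y by (simp add: z_def a_minus_def Zp_nth Zp_uminus_nth mod_simps)
  then have "z n = 0 \<longleftrightarrow> x n = y n"
    using x y by (metis Zp_nth_mod mod_eq_dvd_iff mod_eq_0_iff_dvd)
  moreover have "z \<in> PIdl\<^bsub>Zp p\<^esub> (Zp_of_nat p (p ^ n)) \<longleftrightarrow> z n = 0"
  proof
    assume "z \<in> PIdl\<^bsub>Zp p\<^esub> (Zp_of_nat p (p ^ n))"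
    then show "z n = 0"
      by (auto simp: cgenideal_def Zp_nth Zp_of_nat_nth)
  next
    assume 0: "z n = 0"
    \<comment> \<open>The quotient by \<open>p ^ n\<close>. Division costs \<open>n\<close> levels
      of precision: \<open>z (m + n)\<close> is a residue modulo \<open>p ^ (m + n)\<close>, so its
      quotient is one modulo \<open>p ^ m\<close>; hence the shifted index.\<close>
    define r where "r m = z (m + n) div int p ^ n" for m
    have dvd: "int p ^ n dvd z (m + n)" for m
      using Zp_nth_mod_le[OF z, of n "m + n"] 0 by (simp add: mod_eq_0_iff_dvd)
    have r_eq: "r m * int p ^ n = z (m + n)" for m
      using dvd by (simp add: r_def)
    have "r \<in> carrier (Zp p)"
      unfolding carrier_Zp_iff
    proof (intro allI conjI)
      fix m
      have "z (m + n) < int p ^ m * int p ^ n" "0 \<le> z (m + n)"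
        using z by (simp_all add: carrier_Zp_iff flip: power_add)
      then show r_m: "r m \<in> {0..<int p ^ m}"
        unfolding r_eq[symmetric] using power_p_pos[of n] by (simp add: zero_le_mult_iff)
      have "(r (Suc m) * int p ^ n) mod (int p ^ m * int p ^ n) = r m * int p ^ n"
        using z unfolding r_eq by (simp add: carrier_Zp_iff flip: power_add)
      then have "(r (Suc m) mod int p ^ m) * int p ^ n = r m * int p ^ n"
        by (simp only: mult_mod_left)
      then show "r (Suc m) mod int p ^ m = r m"
        using power_p_pos[of n] by (metis mult_cancel_right order_less_irrefl)
    qed
    moreover have "z = r \<otimes>\<^bsub>Zp p\<^esub> Zp_of_nat p (p ^ n)"
      using r_eq Zp_nth_mod_le[OF z] by (simp add: fun_eq_iff Zp_nth Zp_of_nat_nth mod_simps)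
    ultimately show "z \<in> PIdl\<^bsub>Zp p\<^esub> (Zp_of_nat p (p ^ n))"
      unfolding cgenideal_def by blast
  qed
  ultimately show ?thesis
    unfolding Zp_cong_def z_def by simp
qed

text \<open>Z_p is local: a first residue prime to \<open>p\<close> keeps every \<open>x n\<close>
  prime to \<open>p ^ n\<close>, and inverses modulo \<open>p ^ n\<close> are unique, so inverses
  taken level by level fit together. Constancy modulo \<open>p\<close> can thus carry invertibility
  from one value to all.\<close>

lemma Zp_Units_iff: "x \<in> Units (Zp p) \<longleftrightarrow> x \<in> carrier (Zp p) \<and> coprime (x 1) (int p)"
proof (intro iffI conjI)
  assume x: "x \<in> Units (Zp p)"
  then show "x \<in> carrier (Zp p)" by (rule Z.Units_closed)
  obtain y where "y \<otimes>\<^bsub>Zp p\<^esub> x = \<one>\<^bsub>Zp p\<^esub>"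
    using x by (auto simp: Units_def)
  then have "(y \<otimes>\<^bsub>Zp p\<^esub> x) 1 = \<one>\<^bsub>Zp p\<^esub> 1" by simp
  then have "[x 1 * y 1 = 1] (mod int p)"
    by (simp add: Zp_nth cong_def mult.commute)
  then show "coprime (x 1) (int p)"
    using coprime_iff_invertible_int by blast
next
  assume "x \<in> carrier (Zp p) \<and> coprime (x 1) (int p)"
  then have x: "x \<in> carrier (Zp p)" and coprime_1: "coprime (x 1) (int p)" by auto
  have coprime: "coprime (x n) (int p ^ n)" for n
  proof (cases n)
    case (Suc m)
    have "[x n = x 1] (mod int p)"
      using Zp_nth_mod_le[OF x, of 1 n] Zp_nth_mod[OF x, of 1] Suc by (simp add: cong_def)
    then have "coprime (x n) (int p)"
      using coprime_1 cong_imp_coprime cong_sym by blast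
    then show ?thesis by simp
  qed simp
  \<comment> \<open>Arbitrary choices at each level; their compatibility follows by cancelling
    \<open>x n\<close>, which is prime to the modulus.\<close>
  define y where "y n = (SOME v. [x n * v = 1] (mod int p ^ n))" for n
  have y: "[x n * y n = 1] (mod int p ^ n)" for n
    unfolding y_def using cong_solve_coprime_int[OF coprime] by (rule someI_ex)
  have "[y (Suc n) = y n] (mod int p ^ n)" for n
  proof -
    have "[x (Suc n) * y (Suc n) = 1] (mod int p ^ n)"
      using y[of "Suc n"] by (rule cong_dvd_modulus) simp
    moreover have "[x (Suc n) * y (Suc n) = x n * y (Suc n)] (mod int p ^ n)"
      by (intro cong_scalar_right cong_nth_Suc x)
    ultimately have "[x n * y (Suc n) = x n * y n] (mod int p ^ n)"
      using y[of n] by (meson cong_sym cong_trans)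
    then show ?thesis using coprime by (simp add: cong_mult_lcancel)
  qed
  then have y_closed: "(\<lambda>n. y n mod int p ^ n) \<in> carrier (Zp p)"
    by (rule mod_power_in_carrier_Zp)
  have "x \<otimes>\<^bsub>Zp p\<^esub> (\<lambda>n. y n mod int p ^ n) = \<one>\<^bsub>Zp p\<^esub>"
    using y by (simp add: fun_eq_iff Zp_nth mod_simps cong_def)
  then show "x \<in> Units (Zp p)"
    using x y_closed Z.m_comm[OF x y_closed] unfolding Units_def by auto
qed

lemma Zp_cong_inv:
  assumes "x \<in> Units (Zp p)"
  shows "[x n * (inv\<^bsub>Zp p\<^esub> x) n = 1] (mod int p ^ n)"
proof -
  have "(x \<otimes>\<^bsub>Zp p\<^esub> inv\<^bsub>Zp p\<^esub> x) n = \<one>\<^bsub>Zp p\<^esub> n"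
    using assms by simp
  then show ?thesis by (simp add: Zp_nth cong_def)
qed

text \<open>Uniqueness of inverses modulo \<open>p ^ n\<close>, by evaluating a product of
  \<open>x\<close> and both inverses in two ways. Inversion therefore preserves the gain of one
  level in the first space and continuity in the second.\<close>

lemma Zp_inv_nth_eq:
  assumes x: "x \<in> Units (Zp p)" and y: "y \<in> Units (Zp p)" and "x n = y n"
  shows "(inv\<^bsub>Zp p\<^esub> x) n = (inv\<^bsub>Zp p\<^esub> y) n"
proof -
  let ?u = "(inv\<^bsub>Zp p\<^esub> x) n" and ?v = "(inv\<^bsub>Zp p\<^esub> y) n"
  have "[?u * (x n * ?v) = ?u * 1] (mod int p ^ n)"
    using Zp_cong_inv[OF y, of n] assms(3) by (intro cong_scalar_left) simp
  moreover have "[(x n * ?u) * ?v = 1 * ?v] (mod int p ^ n)"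
    using Zp_cong_inv[OF x, of n] by (rule cong_scalar_right)
  ultimately have "[?u = ?v] (mod int p ^ n)"
    by (simp add: ac_simps) (meson cong_sym cong_trans)
  then show ?thesis
    using x y by (metis Zp_nth_mod Z.Units_inv_closed cong_def)
qed

section \<open>Pointwise function rings and their units\<close>

text \<open>The ring laws hold value by value, and extensionality lifts them to equalities of
  functions. Negation is multiplication by the constant function -1, so \<open>mult\<close> and
  \<open>const\<close> yield it.\<close>

lemma cring_pointwise_ring:
  assumes K: "K \<subseteq> carrier (Zp p) \<rightarrow>\<^sub>E carrier (Zp p)"
    and const: "\<And>c. c \<in> carrier (Zp p) \<Longrightarrow> (\<lambda>s\<in>carrier (Zp p). c) \<in> K"
    and add: "\<And>f g. f \<in> K \<Longrightarrow> g \<in> K \<Longrightarrow> (\<lambda>s\<in>carrier (Zp p). f s \<oplus>\<^bsub>Zp p\<^esub> g s) \<in> K"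
    and mult: "\<And>f g. f \<in> K \<Longrightarrow> g \<in> K \<Longrightarrow> (\<lambda>s\<in>carrier (Zp p). f s \<otimes>\<^bsub>Zp p\<^esub> g s) \<in> K"
  shows "cring (pointwise_ring p K)"
proof (rule cringI)
  have closed: "f s \<in> carrier (Zp p)" if "f \<in> K" "s \<in> carrier (Zp p)" for f s
    using K that by blast
  have ext: "f \<in> extensional (carrier (Zp p))" if "f \<in> K" for f
    using K that by (auto simp: PiE_iff)
  show "abelian_group (pointwise_ring p K)"
  proof (rule abelian_groupI)
    fix f assume f: "f \<in> carrier (pointwise_ring p K)"
    have "(\<lambda>s\<in>carrier (Zp p). (\<lambda>s\<in>carrier (Zp p). \<ominus>\<^bsub>Zp p\<^esub> \<one>\<^bsub>Zp p\<^esub>) s \<otimes>\<^bsub>Zp p\<^esub> f s) \<in> K"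
      using f by (intro mult const) (simp_all add: pointwise_ring_def)
    then have "(\<lambda>s\<in>carrier (Zp p). \<ominus>\<^bsub>Zp p\<^esub> f s) \<in> K"
      using f closed by (simp add: pointwise_ring_def Z.l_minus cong: restrict_cong)
    then show "\<exists>g\<in>carrier (pointwise_ring p K). g \<oplus>\<^bsub>pointwise_ring p K\<^esub> f = \<zero>\<^bsub>pointwise_ring p K\<^esub>"
      using f closed by (intro bexI) (auto simp: pointwise_ring_def Z.l_neg)
  qed (auto simp: pointwise_ring_def add const closed ext Z.a_ac
      intro!: extensionalityI[of _ "carrier (Zp p)"])
  show "comm_monoid (pointwise_ring p K)"
    by (rule comm_monoidI)
      (auto simp: pointwise_ring_def mult const closed ext Z.m_ac
      intro!: extensionalityI[of _ "carrier (Zp p)"])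
  show "(f \<oplus>\<^bsub>pointwise_ring p K\<^esub> g) \<otimes>\<^bsub>pointwise_ring p K\<^esub> h =
      f \<otimes>\<^bsub>pointwise_ring p K\<^esub> h \<oplus>\<^bsub>pointwise_ring p K\<^esub> g \<otimes>\<^bsub>pointwise_ring p K\<^esub> h"
    if "f \<in> carrier (pointwise_ring p K)" "g \<in> carrier (pointwise_ring p K)"
      "h \<in> carrier (pointwise_ring p K)" for f g h
    using that by (auto simp: pointwise_ring_def closed Z.l_distr intro!: restrict_ext)
qed

text \<open>Assumption \<open>units\<close> is constancy modulo \<open>p\<close>, and
  \<open>Zp_Units_iff\<close> decides invertibility modulo \<open>p\<close>; so a unit value at zero
  forces unit values everywhere, and \<open>inv\<close> puts the pointwise inverse in
  \<open>K\<close>.\<close>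

lemma Units_pointwise_ring:
  assumes K: "K \<subseteq> carrier (Zp p) \<rightarrow>\<^sub>E carrier (Zp p)"
    and units: "\<And>f s. f \<in> K \<Longrightarrow> s \<in> carrier (Zp p) \<Longrightarrow> f s 1 = f \<zero>\<^bsub>Zp p\<^esub> 1"
    and inv: "\<And>f. f \<in> K \<Longrightarrow> (\<And>s. s \<in> carrier (Zp p) \<Longrightarrow> f s \<in> Units (Zp p)) \<Longrightarrow>
      (\<lambda>s\<in>carrier (Zp p). inv\<^bsub>Zp p\<^esub> (f s)) \<in> K"
  shows "Units (pointwise_ring p K) = {f \<in> K. f \<zero>\<^bsub>Zp p\<^esub> \<in> Units (Zp p)}"
proof (intro equalityI subsetI)
  fix f assume "f \<in> Units (pointwise_ring p K)"
  then obtain g where f: "f \<in> K" and g: "g \<in> K"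
    and gf: "(\<lambda>s\<in>carrier (Zp p). g s \<otimes>\<^bsub>Zp p\<^esub> f s) = (\<lambda>s\<in>carrier (Zp p). \<one>\<^bsub>Zp p\<^esub>)"
    by (auto simp: Units_def pointwise_ring_def)
  have "g \<zero>\<^bsub>Zp p\<^esub> \<otimes>\<^bsub>Zp p\<^esub> f \<zero>\<^bsub>Zp p\<^esub> = \<one>\<^bsub>Zp p\<^esub>"
    using fun_cong[OF gf, of "\<zero>\<^bsub>Zp p\<^esub>"] by simp
  moreover have closed: "f \<zero>\<^bsub>Zp p\<^esub> \<in> carrier (Zp p)" "g \<zero>\<^bsub>Zp p\<^esub> \<in> carrier (Zp p)"
    using f g K Z.zero_closed by blast+
  ultimately show "f \<in> {f \<in> K. f \<zero>\<^bsub>Zp p\<^esub> \<in> Units (Zp p)}"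
    using f Z.m_comm[OF closed] unfolding Units_def by auto
next
  fix f assume "f \<in> {f \<in> K. f \<zero>\<^bsub>Zp p\<^esub> \<in> Units (Zp p)}"
  then have f: "f \<in> K" and "f \<zero>\<^bsub>Zp p\<^esub> \<in> Units (Zp p)" by auto
  then have unit: "f s \<in> Units (Zp p)" if "s \<in> carrier (Zp p)" for s
    using that K units[OF f that] by (auto simp: Zp_Units_iff)
  let ?g = "\<lambda>s\<in>carrier (Zp p). inv\<^bsub>Zp p\<^esub> (f s)"
  have "?g \<in> K"
    using f unit by (rule inv)
  moreover have "(\<lambda>s\<in>carrier (Zp p). ?g s \<otimes>\<^bsub>Zp p\<^esub> f s) = (\<lambda>s\<in>carrier (Zp p). \<one>\<^bsub>Zp p\<^esub>)"
    "(\<lambda>s\<in>carrier (Zp p). f s \<otimes>\<^bsub>Zp p\<^esub> ?g s) = (\<lambda>s\<in>carrier (Zp p). \<one>\<^bsub>Zp p\<^esub>)"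
    using unit by (auto intro!: restrict_ext)
  ultimately show "f \<in> Units (pointwise_ring p K)"
    using f unfolding Units_def pointwise_ring_def
    by (simp del: restrict_apply restrict_apply') blast
qed

section \<open>The conditions of both spaces in terms of residues\<close>

text \<open>Through \<open>Zp_cong_iff\<close> the congruences say that \<open>f\<close> gains a
  level: the first \<open>n\<close> digits of \<open>s\<close> fix the first \<open>n + 1\<close>
  digits of \<open>f s\<close>. As the ring operations work level by level, closure becomes easy to
  see.\<close>

lemma Kummer1_iff:
  "f \<in> Kummer1 p \<longleftrightarrow> f \<in> carrier (Zp p) \<rightarrow>\<^sub>E carrier (Zp p) \<and>
     (\<forall>s\<in>carrier (Zp p). \<forall>t\<in>carrier (Zp p). \<forall>n. s n = t n \<longrightarrow> f s (Suc n) = f t (Suc n))"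
proof (cases "f \<in> carrier (Zp p) \<rightarrow>\<^sub>E carrier (Zp p)")
  case True
  then have "f s \<in> carrier (Zp p)" if "s \<in> carrier (Zp p)" for s
    using that by blast
  then show ?thesis
    unfolding Kummer1_def using True by (simp add: Zp_cong_iff) metis
qed (simp add: Kummer1_def)

lemma Zp_continuous_iff:
  assumes "f \<in> carrier (Zp p) \<rightarrow> carrier (Zp p)"
  shows "Zp_continuous p f \<longleftrightarrow>
     (\<forall>s\<in>carrier (Zp p). \<forall>n. \<exists>m. \<forall>t\<in>carrier (Zp p). s m = t m \<longrightarrow> f s n = f t n)"
proof -
  have "f s \<in> carrier (Zp p)" if "s \<in> carrier (Zp p)" for s
    using assms that by (rule funcset_mem)
  then show ?thesis
    unfolding Zp_continuous_def by (simp add: Zp_cong_iff)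
qed

lemma Zp_diff_closed:
  assumes "f \<in> carrier (Zp p) \<rightarrow> carrier (Zp p)" "s \<in> carrier (Zp p)"
  shows "Zp_diff p n f s \<in> carrier (Zp p)"
  unfolding Zp_diff_def using assms
  by (intro Z.finsum_closed) (auto simp: Zp_of_nat_closed intro!: Z.add.int_pow_closed)

lemma Zp_diff_nth:
  assumes "f \<in> carrier (Zp p) \<rightarrow> carrier (Zp p)" "s \<in> carrier (Zp p)"
  shows "Zp_diff p n f s N =
    (fdiff ^^ n) (\<lambda>\<nu>. f (s \<oplus>\<^bsub>Zp p\<^esub> Zp_of_nat p \<nu>) N) 0 mod int p ^ N"
proof -
  have closed: "f (s \<oplus>\<^bsub>Zp p\<^esub> Zp_of_nat p \<nu>) \<in> carrier (Zp p)" for \<nu>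
    using assms Zp_of_nat_closed by auto
  then show ?thesis
    unfolding Zp_diff_def fdiff_funpow_eq_sum
    by (subst Zp_finsum_nth) (auto simp: Zp_int_pow_nth mod_simps)
qed

text \<open>The definition gives order \<open>k\<close> at level \<open>k\<close> from the start of
  each sequence. Here all orders up to a common level \<open>N\<close> are collected on one integer
  sequence, at any position \<open>j\<close>, as the product and inverse lemmas for
  \<open>fdiff\<close> demand. Moving the position replaces \<open>s\<close> by
  \<open>s + j\<close>, and lowering the level is reduction modulo \<open>p ^ k\<close>.\<close>

lemma Kummer2_iff:
  "f \<in> Kummer2 p \<longleftrightarrow> f \<in> carrier (Zp p) \<rightarrow>\<^sub>E carrier (Zp p) \<and>
     (\<forall>s\<in>carrier (Zp p). \<forall>n. \<exists>m. \<forall>t\<in>carrier (Zp p). s m = t m \<longrightarrow> f s n = f t n) \<and>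
     (\<forall>s\<in>carrier (Zp p). \<forall>N. \<forall>k\<le>N. \<forall>j.
        int p ^ k dvd (fdiff ^^ k) (\<lambda>\<nu>. f (s \<oplus>\<^bsub>Zp p\<^esub> Zp_of_nat p \<nu>) N) j)"
  (is "_ \<longleftrightarrow> ?F \<and> ?C \<and> ?D")
proof (cases ?F)
  case True
  let ?a = "\<lambda>s N \<nu>. f (s \<oplus>\<^bsub>Zp p\<^esub> Zp_of_nat p \<nu>) N"
  have f: "f \<in> carrier (Zp p) \<rightarrow> carrier (Zp p)"
    using True by blast
  have cong_0: "Zp_cong p n (Zp_diff p n f s) \<zero>\<^bsub>Zp p\<^esub> \<longleftrightarrow> int p ^ n dvd (fdiff ^^ n) (?a s n) 0"
    if "s \<in> carrier (Zp p)" for s n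
    using f that by (simp add: Zp_cong_iff Zp_diff_closed Zp_diff_nth Zp_nth mod_eq_0_iff_dvd)
  have "?D \<longleftrightarrow> (\<forall>s\<in>carrier (Zp p). \<forall>n. int p ^ n dvd (fdiff ^^ n) (?a s n) 0)" (is "_ \<longleftrightarrow> ?D'")
  proof
    assume D': ?D'
    show ?D
    proof (intro ballI allI impI)
      fix s and N k j :: nat assume s: "s \<in> carrier (Zp p)" and k: "k \<le> N"
      let ?t = "s \<oplus>\<^bsub>Zp p\<^esub> Zp_of_nat p j"
      have t: "?t \<in> carrier (Zp p)"
        using s Zp_of_nat_closed by simp
      have "s \<oplus>\<^bsub>Zp p\<^esub> Zp_of_nat p (\<nu> + j) = ?t \<oplus>\<^bsub>Zp p\<^esub> Zp_of_nat p \<nu>" for \<nu>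
        by (simp add: fun_eq_iff Zp_nth Zp_of_nat_nth mod_simps) (simp add: ac_simps)
      then have "(fdiff ^^ k) (?a s N) j = (fdiff ^^ k) (?a ?t N) 0"
        using fdiff_funpow_shift[of k "?a s N" j 0] by simp
      moreover have "[(fdiff ^^ k) (?a ?t N) 0 = (fdiff ^^ k) (?a ?t k) 0] (mod int p ^ k)"
      proof (rule fdiff_funpow_cong_mod)
        fix \<nu>
        have "f (?t \<oplus>\<^bsub>Zp p\<^esub> Zp_of_nat p \<nu>) \<in> carrier (Zp p)"
          using f t Zp_of_nat_closed by auto
        then show "[?a ?t N \<nu> = ?a ?t k \<nu>] (mod int p ^ k)"
          using k by (simp add: cong_def Zp_nth_mod Zp_nth_mod_le)
      qed
      moreover have "int p ^ k dvd (fdiff ^^ k) (?a ?t k) 0"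
        using D' t by blast
      ultimately show "int p ^ k dvd (fdiff ^^ k) (?a s N) j"
        by (simp add: cong_dvd_iff)
    qed
  qed auto
  then show ?thesis
    unfolding Kummer2_def using True f by (simp add: Zp_continuous_iff cong_0)
qed (simp add: Kummer2_def)

section \<open>Constancy modulo \<open>p\<close> and closure properties of the second space\<close>

lemma Kummer2_closed:
  assumes "f \<in> Kummer2 p" "s \<in> carrier (Zp p)"
  shows "f s \<in> carrier (Zp p)"
proof -
  have "f \<in> carrier (Zp p) \<rightarrow>\<^sub>E carrier (Zp p)"
    using assms(1) by (simp add: Kummer2_def)
  then show ?thesis
    using assms(2) by (rule PiE_mem)
qed

lemma Kummer2_continuous:
  assumes "f \<in> Kummer2 p" "s \<in> carrier (Zp p)"
  obtains m where "\<And>t. t \<in> carrier (Zp p) \<Longrightarrow> s m = t m \<Longrightarrow> f s n = f t n"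
proof -
  have "\<exists>m. \<forall>t\<in>carrier (Zp p). s m = t m \<longrightarrow> f s n = f t n"
    using assms by (simp add: Kummer2_iff)
  then show ?thesis using that by auto
qed

lemma Kummer2_dvd:
  assumes "f \<in> Kummer2 p" "s \<in> carrier (Zp p)" "k \<le> N"
  shows "int p ^ k dvd (fdiff ^^ k) (\<lambda>\<nu>. f (s \<oplus>\<^bsub>Zp p\<^esub> Zp_of_nat p \<nu>) N) j"
  by (rule assms(1)[unfolded Kummer2_iff, THEN conjunct2, THEN conjunct2, rule_format, OF assms(2,3)])

lemma Kummer2_nth_1:
  assumes f: "f \<in> Kummer2 p" and s: "s \<in> carrier (Zp p)"
  shows "f s 1 = f \<zero>\<^bsub>Zp p\<^esub> 1"
proof -
  have closed: "f t \<in> carrier (Zp p)" if "t \<in> carrier (Zp p)" for t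
    using f that by (rule Kummer2_closed)
  have nat: "f (Zp_of_nat p j) 1 = f \<zero>\<^bsub>Zp p\<^esub> 1" for j
  proof (induction j)
    case 0
    have "Zp_of_nat p 0 = \<zero>\<^bsub>Zp p\<^esub>"
      by (simp add: fun_eq_iff Zp_nth Zp_of_nat_nth)
    then show ?case by simp
  next
    case (Suc j)
    have "int p ^ 1 dvd (fdiff ^^ 1) (\<lambda>\<nu>. f (\<zero>\<^bsub>Zp p\<^esub> \<oplus>\<^bsub>Zp p\<^esub> Zp_of_nat p \<nu>) 1) j"
      using f Z.zero_closed by (rule Kummer2_dvd) simp
    then have "f (Zp_of_nat p (Suc j)) 1 mod int p ^ 1 = f (Zp_of_nat p j) 1 mod int p ^ 1"
      using Zp_of_nat_closed by (simp add: fdiff_def mod_eq_dvd_iff)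
    then have "f (Zp_of_nat p (Suc j)) 1 = f (Zp_of_nat p j) 1"
      by (simp only: Zp_nth_mod[OF closed[OF Zp_of_nat_closed]])
    then show ?case
      using Suc by simp
  qed
  obtain m where m: "\<And>t. t \<in> carrier (Zp p) \<Longrightarrow> s m = t m \<Longrightarrow> f s 1 = f t 1"
    using Kummer2_continuous[OF f s] by metis
  \<comment> \<open>Density: the representative \<open>s m\<close> is itself a natural number and
    agrees with \<open>s\<close> at level \<open>m\<close>, where continuity controls
    \<open>f\<close> modulo \<open>p\<close>.\<close>
  have "0 \<le> s m" using s by (simp add: carrier_Zp_iff)
  then have "Zp_of_nat p (nat (s m)) m = s m"
    using s by (simp add: Zp_of_nat_nth Zp_nth_mod)
  then show ?thesis
    using m[OF Zp_of_nat_closed] nat by metis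
qed

text \<open>Translates of \<open>s\<close> by natural numbers stay in the carrier, so the
  restriction does not show in the differences.\<close>

lemma Kummer2_restrictI:
  assumes closed: "\<And>s. s \<in> carrier (Zp p) \<Longrightarrow> h s \<in> carrier (Zp p)"
    and cont: "\<And>s n. s \<in> carrier (Zp p) \<Longrightarrow>
      \<exists>m. \<forall>t\<in>carrier (Zp p). s m = t m \<longrightarrow> h s n = h t n"
    and diff: "\<And>s N k j. s \<in> carrier (Zp p) \<Longrightarrow> k \<le> N \<Longrightarrow>
      int p ^ k dvd (fdiff ^^ k) (\<lambda>\<nu>. h (s \<oplus>\<^bsub>Zp p\<^esub> Zp_of_nat p \<nu>) N) j"
  shows "(\<lambda>s\<in>carrier (Zp p). h s) \<in> Kummer2 p"
  unfolding Kummer2_iff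
proof (intro conjI ballI allI impI)
  fix s assume s: "s \<in> carrier (Zp p)"
  show "\<exists>m. \<forall>t\<in>carrier (Zp p). s m = t m \<longrightarrow>
      (\<lambda>s\<in>carrier (Zp p). h s) s n = (\<lambda>s\<in>carrier (Zp p). h s) t n" for n
    using cont[OF s, of n] s by simp
  show "int p ^ k dvd
      (fdiff ^^ k) (\<lambda>\<nu>. (\<lambda>s\<in>carrier (Zp p). h s) (s \<oplus>\<^bsub>Zp p\<^esub> Zp_of_nat p \<nu>) N) j"
    if "k \<le> N" for k N j
    using diff[OF s that, of j] s Zp_of_nat_closed by simp
qed (use closed in auto)

text \<open>The operations of \<open>Zp\<close> compute in the integers and then reduce modulo
  \<open>p ^ N\<close>; for \<open>k \<le> N\<close> this does not affect divisibility by
  \<open>p ^ k\<close>.\<close>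

lemma dvd_fdiff_funpow_mod:
  assumes "k \<le> N" "int p ^ k dvd (fdiff ^^ k) a j"
  shows "int p ^ k dvd (fdiff ^^ k) (\<lambda>\<nu>. a \<nu> mod int p ^ N) j"
proof -
  have "[(fdiff ^^ k) (\<lambda>\<nu>. a \<nu> mod int p ^ N) j = (fdiff ^^ k) a j] (mod int p ^ k)"
    using assms(1) by (intro fdiff_funpow_cong_mod) (simp add: cong_def mod_mod_cancel le_imp_power_dvd)
  then show ?thesis
    using assms(2) by (simp add: cong_dvd_iff)
qed

text \<open>Agreement at a level passes to all lower levels, so the maximum of two levels serves
  both functions.\<close>

lemma Kummer2_continuous_pair:
  assumes f: "f \<in> Kummer2 p" and g: "g \<in> Kummer2 p" and s: "s \<in> carrier (Zp p)"
  obtains m where "\<And>t. t \<in> carrier (Zp p) \<Longrightarrow> s m = t m \<Longrightarrow> f s n = f t n \<and> g s n = g t n"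
proof -
  obtain m1 where m1: "\<And>t. t \<in> carrier (Zp p) \<Longrightarrow> s m1 = t m1 \<Longrightarrow> f s n = f t n"
    using Kummer2_continuous[OF f s] by metis
  obtain m2 where m2: "\<And>t. t \<in> carrier (Zp p) \<Longrightarrow> s m2 = t m2 \<Longrightarrow> g s n = g t n"
    using Kummer2_continuous[OF g s] by metis
  have "s m1 = t m1 \<and> s m2 = t m2" if "t \<in> carrier (Zp p)" "s (max m1 m2) = t (max m1 m2)" for t
    using that s by (metis Zp_nth_mod_le max.cobounded1 max.cobounded2)
  then show ?thesis
    using that m1 m2 by blast
qed

lemma Kummer2_const:
  assumes "c \<in> carrier (Zp p)"
  shows "(\<lambda>s\<in>carrier (Zp p). c) \<in> Kummer2 p"
proof (rule Kummer2_restrictI)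
  fix k N j
  have "fdiff (\<lambda>\<nu>. c N) = (\<lambda>\<nu>. 0)"
    by (simp add: fun_eq_iff fdiff_def)
  \<comment> \<open>For the zero sequence, \<open>fdiff_funpow_uminus\<close> says that the value
    equals its own negative.\<close>
  moreover have "(fdiff ^^ i) (\<lambda>\<nu>. 0) j = 0" for i
    using fdiff_funpow_uminus[of i "\<lambda>\<nu>. 0" j] by simp
  ultimately show "int p ^ k dvd (fdiff ^^ k) (\<lambda>\<nu>. c N) j"
    by (cases k) (simp_all del: funpow.simps add: funpow_Suc_right)
qed (use assms in auto)

lemma Kummer2_add:
  assumes f: "f \<in> Kummer2 p" and g: "g \<in> Kummer2 p"
  shows "(\<lambda>s\<in>carrier (Zp p). f s \<oplus>\<^bsub>Zp p\<^esub> g s) \<in> Kummer2 p"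
proof (rule Kummer2_restrictI)
  fix s assume s: "s \<in> carrier (Zp p)"
  show "f s \<oplus>\<^bsub>Zp p\<^esub> g s \<in> carrier (Zp p)"
    using f g s by (simp add: Kummer2_closed)
  show "\<exists>m. \<forall>t\<in>carrier (Zp p). s m = t m \<longrightarrow> (f s \<oplus>\<^bsub>Zp p\<^esub> g s) n = (f t \<oplus>\<^bsub>Zp p\<^esub> g t) n" for n
    using Kummer2_continuous_pair[OF f g s, of n] unfolding Zp_nth by metis
  show "int p ^ k dvd
      (fdiff ^^ k) (\<lambda>\<nu>. (f (s \<oplus>\<^bsub>Zp p\<^esub> Zp_of_nat p \<nu>) \<oplus>\<^bsub>Zp p\<^esub> g (s \<oplus>\<^bsub>Zp p\<^esub> Zp_of_nat p \<nu>)) N) j"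
    if "k \<le> N" for k N j
    unfolding Zp_add_nth[of p "f u" "g v" for u v] using f g s that
    by (intro dvd_fdiff_funpow_mod) (simp_all add: fdiff_funpow_add Kummer2_dvd)
qed

lemma Kummer2_mult:
  assumes f: "f \<in> Kummer2 p" and g: "g \<in> Kummer2 p"
  shows "(\<lambda>s\<in>carrier (Zp p). f s \<otimes>\<^bsub>Zp p\<^esub> g s) \<in> Kummer2 p"
proof (rule Kummer2_restrictI)
  fix s assume s: "s \<in> carrier (Zp p)"
  show "f s \<otimes>\<^bsub>Zp p\<^esub> g s \<in> carrier (Zp p)"
    using f g s by (simp add: Kummer2_closed)
  show "\<exists>m. \<forall>t\<in>carrier (Zp p). s m = t m \<longrightarrow> (f s \<otimes>\<^bsub>Zp p\<^esub> g s) n = (f t \<otimes>\<^bsub>Zp p\<^esub> g t) n" for n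
    using Kummer2_continuous_pair[OF f g s, of n] unfolding Zp_nth by metis
  show "int p ^ k dvd
      (fdiff ^^ k) (\<lambda>\<nu>. (f (s \<oplus>\<^bsub>Zp p\<^esub> Zp_of_nat p \<nu>) \<otimes>\<^bsub>Zp p\<^esub> g (s \<oplus>\<^bsub>Zp p\<^esub> Zp_of_nat p \<nu>)) N) j"
    if "k \<le> N" for k N j
  proof -
    let ?a = "\<lambda>h \<nu>. h (s \<oplus>\<^bsub>Zp p\<^esub> Zp_of_nat p \<nu>) N"
    have "int p ^ (k + 0 + 0) dvd (fdiff ^^ k) (\<lambda>\<nu>. ?a f \<nu> * ?a g \<nu>) j"
      using f g s that by (intro dvd_fdiff_funpow_mult) (simp_all add: Kummer2_dvd)
    then show ?thesis
      unfolding Zp_mult_nth using that by (intro dvd_fdiff_funpow_mod) simp_all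
  qed
qed

lemma Kummer2_inv:
  assumes f: "f \<in> Kummer2 p" and unit: "\<And>s. s \<in> carrier (Zp p) \<Longrightarrow> f s \<in> Units (Zp p)"
  shows "(\<lambda>s\<in>carrier (Zp p). inv\<^bsub>Zp p\<^esub> (f s)) \<in> Kummer2 p"
proof (rule Kummer2_restrictI)
  fix s assume s: "s \<in> carrier (Zp p)"
  show "inv\<^bsub>Zp p\<^esub> (f s) \<in> carrier (Zp p)"
    using unit s by simp
  show "\<exists>m. \<forall>t\<in>carrier (Zp p). s m = t m \<longrightarrow> (inv\<^bsub>Zp p\<^esub> (f s)) n = (inv\<^bsub>Zp p\<^esub> (f t)) n" for n
    using Kummer2_continuous_pair[OF f f s, of n] Zp_inv_nth_eq unit s by metis
  show "int p ^ k dvd (fdiff ^^ k) (\<lambda>\<nu>. (inv\<^bsub>Zp p\<^esub> (f (s \<oplus>\<^bsub>Zp p\<^esub> Zp_of_nat p \<nu>))) N) j"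
    if "k \<le> N" for k N j
  proof (rule dvd_fdiff_funpow_inverse[OF _ _ that])
    show "int p ^ i dvd (fdiff ^^ i) (\<lambda>\<nu>. f (s \<oplus>\<^bsub>Zp p\<^esub> Zp_of_nat p \<nu>) N) j" if "i \<le> N" for i j
      using f s that by (rule Kummer2_dvd)
    show "[f (s \<oplus>\<^bsub>Zp p\<^esub> Zp_of_nat p j) N * (inv\<^bsub>Zp p\<^esub> (f (s \<oplus>\<^bsub>Zp p\<^esub> Zp_of_nat p j))) N = 1]
        (mod int p ^ N)" for j
      using s Zp_of_nat_closed by (intro Zp_cong_inv unit) simp
  qed
qed

end

section \<open>Verification for the first space and assembly of the four claims\<close>

theorem theorem6p1:
  fixes p :: nat
  assumes "prime p"
  shows "cring (pointwise_ring p (Kummer1 p)) \<and>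
         cring (pointwise_ring p (Kummer2 p)) \<and>
         Units (pointwise_ring p (Kummer1 p)) = {f \<in> Kummer1 p. f \<zero>\<^bsub>Zp p\<^esub> \<in> Units (Zp p)} \<and>
         Units (pointwise_ring p (Kummer2 p)) = {f \<in> Kummer2 p. f \<zero>\<^bsub>Zp p\<^esub> \<in> Units (Zp p)}"
proof (intro conjI)
  interpret Z: cring "Zp p"
    using assms by (rule cring_Zp)
  note Kummer1_iff = Kummer1_iff[OF assms]
  have Kummer1: "Kummer1 p \<subseteq> carrier (Zp p) \<rightarrow>\<^sub>E carrier (Zp p)"
    and Kummer2: "Kummer2 p \<subseteq> carrier (Zp p) \<rightarrow>\<^sub>E carrier (Zp p)"
    by (auto simp: Kummer1_def Kummer2_def)
  show "cring (pointwise_ring p (Kummer1 p))"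
  proof (rule cring_pointwise_ring[OF assms Kummer1])
    fix f g assume fg: "f \<in> Kummer1 p" "g \<in> Kummer1 p"
    then have closed: "f s \<in> carrier (Zp p)" "g s \<in> carrier (Zp p)" if "s \<in> carrier (Zp p)" for s
      using that Kummer1 by blast+
    have nth: "f s (Suc n) = f t (Suc n)" "g s (Suc n) = g t (Suc n)"
      if "s \<in> carrier (Zp p)" "t \<in> carrier (Zp p)" "s n = t n" for s t n
      using fg that unfolding Kummer1_iff by blast+
    show "(\<lambda>s\<in>carrier (Zp p). f s \<oplus>\<^bsub>Zp p\<^esub> g s) \<in> Kummer1 p"
      unfolding Kummer1_iff by (auto simp: Zp_add_nth closed) (metis nth)
    show "(\<lambda>s\<in>carrier (Zp p). f s \<otimes>\<^bsub>Zp p\<^esub> g s) \<in> Kummer1 p"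
      unfolding Kummer1_iff by (auto simp: Zp_mult_nth closed) (metis nth)
  qed (simp add: Kummer1_iff)
  show "cring (pointwise_ring p (Kummer2 p))"
    by (rule cring_pointwise_ring[OF assms Kummer2])
      (fact Kummer2_const[OF assms] Kummer2_add[OF assms] Kummer2_mult[OF assms])+
  show "Units (pointwise_ring p (Kummer1 p)) = {f \<in> Kummer1 p. f \<zero>\<^bsub>Zp p\<^esub> \<in> Units (Zp p)}"
  proof (rule Units_pointwise_ring[OF assms Kummer1])
    fix f s assume f: "f \<in> Kummer1 p" and s: "s \<in> carrier (Zp p)"
    \<comment> \<open>Level 0 is taken modulo 1, so all points agree there; the condition of the
      first space at \<open>n = 0\<close> then gives constancy modulo \<open>p\<close>.\<close>
    have "s 0 = \<zero>\<^bsub>Zp p\<^esub> 0"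
      using Zp_nth_mod[OF s, of 0] by (simp add: Zp_zero_nth)
    then have "f s (Suc 0) = f \<zero>\<^bsub>Zp p\<^esub> (Suc 0)"
      using f s Z.zero_closed unfolding Kummer1_iff by blast
    then show "f s 1 = f \<zero>\<^bsub>Zp p\<^esub> 1" by simp
  next
    fix f assume f: "f \<in> Kummer1 p" and unit: "\<And>s. s \<in> carrier (Zp p) \<Longrightarrow> f s \<in> Units (Zp p)"
    have "f s (Suc n) = f t (Suc n)"
      if "s \<in> carrier (Zp p)" "t \<in> carrier (Zp p)" "s n = t n" for s t n
      using f that unfolding Kummer1_iff by blast
    then have inv_nth: "(inv\<^bsub>Zp p\<^esub> (f s)) (Suc n) = (inv\<^bsub>Zp p\<^esub> (f t)) (Suc n)"
      if "s \<in> carrier (Zp p)" "t \<in> carrier (Zp p)" "s n = t n" for s t n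
      using that by (intro Zp_inv_nth_eq[OF assms] unit)
    show "(\<lambda>s\<in>carrier (Zp p). inv\<^bsub>Zp p\<^esub> (f s)) \<in> Kummer1 p"
      unfolding Kummer1_iff by (auto simp: unit) (metis inv_nth)
  qed
  show "Units (pointwise_ring p (Kummer2 p)) = {f \<in> Kummer2 p. f \<zero>\<^bsub>Zp p\<^esub> \<in> Units (Zp p)}"
    by (rule Units_pointwise_ring[OF assms Kummer2])
      (fact Kummer2_nth_1[OF assms] Kummer2_inv[OF assms])+
qed

end
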